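(* Suppose $K$ is a perfect field of type $(\mathrm{F})$. Then $K$ satisfies $(\mathrm{F}'_m)$ for all integers $m \geq 1$ prime to $\mathrm{char}\, K$.
   Context: Type $(\mathrm{F})$ (Serre): a perfect field $K$ is of type $(\mathrm{F})$ if its absolute Galois group $G_K = \mathrm{Gal}(\overline{K}/K)$ has, for every integer $n \geq 1$, only finitely many open subgroups of index $n$ (equivalently, a fixed separable closure $\overline{K}$ contains only finitely many extensions of $K$ of degree $n$, for every $n$). Type $(\mathrm{F}'_m)$: for a field $K$ and an integer $m \geq 1$ prime to $\mathrm{char}\, K$, the field $K$ is said to be of type $(\mathrm{F}'_m)$ (or to satisfy $(\mathrm{F}'_m)$) if for every finite separable extension $L/K$, the quotient $L^{\times}/{L^{\times}}^m$ is finite. *)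

theory Defs
  imports
    "HOL-Analysis.Analysis"
    "HOL-Algebra.Algebra"
    "HOL-Algebra.Algebraic_Closure_Type"
begin

text \<open>
  The base field \<open>K\<close> is a type \<open>'a :: field\<close>. Its algebraic closure is the library type
  \<open>'a alg_closure\<close>, with canonical embedding \<^const>\<open>to_ac\<close>. For perfect \<open>K\<close>, the only case of
  interest below, this is also a separable closure. An extension of \<open>K\<close> is a type
  \<open>'b :: field\<close> together with a ring homomorphism \<open>i :: 'a \<Rightarrow> 'b\<close>.
\<close>

section \<open>Separability and perfect fields\<close>

text \<open>No repeated roots in an algebraic closure.\<close>
definition separable_poly :: "'a::field poly \<Rightarrow> bool" where
  "separable_poly p \<longleftrightarrow> rsquarefree (map_poly to_ac p)"

definition perfect_field :: "'a::field itself \<Rightarrow> bool" where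
  "perfect_field _ \<longleftrightarrow> (\<forall>p :: 'a poly. Factorial_Ring.irreducible p \<longrightarrow> separable_poly p)"

section \<open>Field extensions\<close>

definition field_extension :: "('a::field \<Rightarrow> 'b::field) \<Rightarrow> bool" where
  "field_extension i \<longleftrightarrow>
     i \<in> ring_hom (ring_of_type_algebra :: 'a ring) (ring_of_type_algebra :: 'b ring)"

text \<open>
  The linear span over \<open>K\<close>, where \<open>K\<close> acts through \<open>i\<close>. The qualified name refers to the type
  class based vector spaces; the plain one would be that of the modules of HOL-Algebra.
\<close>
definition span_over :: "('a::field \<Rightarrow> 'b::field) \<Rightarrow> 'b set \<Rightarrow> 'b set" where
  "span_over i = Modules.module.span (\<lambda>c x. i c * x)"

definition finite_field_extension :: "('a::field \<Rightarrow> 'b::field) \<Rightarrow> bool" where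
  "finite_field_extension i \<longleftrightarrow> field_extension i \<and> (\<exists>B. finite B \<and> span_over i B = UNIV)"

text \<open>The irreducible polynomial \<open>p\<close> is, up to a unit, the minimal polynomial of \<open>x\<close>.\<close>
definition separable_field_extension :: "('a::field \<Rightarrow> 'b::field) \<Rightarrow> bool" where
  "separable_field_extension i \<longleftrightarrow> field_extension i \<and>
     (\<forall>x. \<exists>p :: 'a poly. Factorial_Ring.irreducible p \<and>
        poly (map_poly i p) x = 0 \<and> separable_poly p)"

section \<open>The absolute Galois group\<close>

definition finite_subextension :: "'a::field alg_closure set \<Rightarrow> bool" where
  "finite_subextension E \<longleftrightarrow>
     subfield E (ring_of_type_algebra :: 'a alg_closure ring) \<and>
     range to_ac \<subseteq> E \<and> (\<exists>B. finite B \<and> span_over to_ac B = E)"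

definition automorphisms_fixing ::
    "'a::field alg_closure set \<Rightarrow> ('a alg_closure \<Rightarrow> 'a alg_closure) set" where
  "automorphisms_fixing E =
     {\<sigma> \<in> ring_iso ring_of_type_algebra ring_of_type_algebra. \<forall>x\<in>E. \<sigma> x = x}"

definition absolute_galois_group :: "('a::field alg_closure \<Rightarrow> 'a alg_closure) monoid" where
  "absolute_galois_group =
     \<lparr>carrier = automorphisms_fixing (range to_ac), monoid.mult = (\<circ>), one = id\<rparr>"

text \<open>
  The Krull topology: the cosets of the groups \<open>Gal(Kbar/E)\<close>, for \<open>E\<close> finite over \<open>K\<close>, are a
  basis.
\<close>
definition krull_topology :: "('a::field alg_closure \<Rightarrow> 'a alg_closure) topology" where
  "krull_topology = topology_generated_by
     {\<sigma> <#\<^bsub>absolute_galois_group\<^esub> automorphisms_fixing E | \<sigma> E.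
        \<sigma> \<in> carrier absolute_galois_group \<and> finite_subextension E}"

section \<open>Types (F) and (F'm)\<close>

text \<open>Requiring \<open>card \<dots> = n\<close> with \<open>n \<ge> 1\<close> forces the index to be finite.\<close>
definition type_F :: "'a::field itself \<Rightarrow> bool" where
  "type_F _ \<longleftrightarrow> (\<forall>n\<ge>1. finite
     {H. subgroup H (absolute_galois_group :: ('a alg_closure \<Rightarrow> 'a alg_closure) monoid) \<and>
         openin krull_topology H \<and>
         card (rcosets\<^bsub>absolute_galois_group\<^esub> H) = n})"

definition power_quotient :: "'b::field itself \<Rightarrow> nat \<Rightarrow> 'b set monoid" where
  "power_quotient _ m = (let G = units_of (ring_of_type_algebra :: 'b ring) in
     G Mod ((\<lambda>x. x [^]\<^bsub>G\<^esub> m) ` carrier G))"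

text \<open>
  A definition in HOL cannot quantify over types, so the type \<open>'b\<close> carrying the extensions \<open>L\<close> of
  \<open>K\<close> is a parameter. A theorem that leaves \<open>'b\<close> free covers all finite separable extensions.
\<close>
definition type_F' :: "'a::field itself \<Rightarrow> 'b::field itself \<Rightarrow> nat \<Rightarrow> bool" where
  "type_F' _ _ m \<longleftrightarrow> (\<forall>i :: 'a \<Rightarrow> 'b. finite_field_extension i \<and> separable_field_extension i \<longrightarrow>
     finite (carrier (power_quotient TYPE('b) m)))"

end

theory Submission
  imports Defs
begin

text \<open>
  Embed \<open>L\<close> in the algebraic closure \<open>Kbar\<close> and pick \<open>\<alpha>\<close> with \<open>\<alpha>\<^sup>m = a\<close> for each \<open>a \<in> L\<^sup>\<times>\<close>. The
  stabilizer of \<open>L(\<alpha>)\<close> in \<open>Gal(Kbar/K)\<close> is open, and its index is bounded in terms of \<open>L\<close> and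
  \<open>m\<close> only, so by (F) finitely many subgroups occur. The function \<open>\<tau> \<mapsto> \<tau>\<^sup>-\<^sup>1 \<alpha> / \<alpha>\<close> on
  \<open>Gal(Kbar/L)\<close> takes values in the \<open>m\<close>-th roots of unity and is constant on right cosets of this
  stabilizer, so only finitely many such functions occur as well. If \<open>\<alpha>\<close> and \<open>\<beta>\<close> give the same
  function, then \<open>\<alpha> / \<beta>\<close> is fixed by \<open>Gal(Kbar/L)\<close> and hence lies in \<open>L\<close>, as \<open>K\<close> is perfect.
\<close>

section \<open>Extending embeddings into an algebraically closed field\<close>

lemma field_extension_iff:
  "field_extension i \<longleftrightarrow> i 1 = 1 \<and> (\<forall>x y. i (x + y) = i x + i y) \<and> (\<forall>x y. i (x * y) = i x * i y)"
  by (auto simp: field_extension_def ring_hom_def ring_of_type_algebra_def)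

section \<open>Arithmetic of field homomorphisms\<close>

locale field_embedding =
  fixes i :: "'a::field \<Rightarrow> 'b::field"
  assumes extension: "field_extension i"
begin

lemma hom_one [simp]: "i 1 = 1"
  and hom_add: "i (x + y) = i x + i y"
  and hom_mult: "i (x * y) = i x * i y"
  using extension by (auto simp: field_extension_iff)

lemma hom_zero [simp]: "i 0 = 0"
  by (metis hom_add add_0 add_left_cancel add.right_neutral)

lemma hom_uminus: "i (- x) = - i x"
  using hom_add[of x "- x"] by (simp add: eq_neg_iff_add_eq_0 add.commute)

lemma hom_eq_zero_iff [simp]: "i x = 0 \<longleftrightarrow> x = 0"
proof
  assume "i x = 0"
  then show "x = 0"
    using hom_mult[of x "inverse x"] by (cases "x = 0") auto
qed simp

lemma hom_eq_iff [simp]: "i x = i y \<longleftrightarrow> x = y"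
  using hom_eq_zero_iff[of "x - y"] hom_add[of x "- y"]
  by (simp add: hom_uminus del: hom_eq_zero_iff)

lemma hom_inverse: "i (inverse x) = inverse (i x)"
  using hom_mult[of x "inverse x"] by (cases "x = 0") (auto simp: inverse_unique)

lemma hom_divide: "i (x / y) = i x / i y"
  by (simp add: divide_inverse hom_mult hom_inverse)

lemma hom_power: "i (x ^ n) = i x ^ n"
  by (induction n) (simp_all add: hom_mult)

lemma hom_sum: "i (sum f A) = (\<Sum>x\<in>A. i (f x))"
  by (induction A rule: infinite_finite_induct) (simp_all add: hom_add)

lemma hom_poly: "i (poly p x) = poly (map_poly i p) (i x)"
  by (induction p) (simp_all add: hom_add hom_mult map_poly_pCons)

lemma map_poly_add: "map_poly i (p + q) = map_poly i p + map_poly i q"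
  by (rule poly_eqI) (simp add: coeff_map_poly hom_add)

lemma map_poly_mult: "map_poly i (p * q) = map_poly i p * map_poly i q"
  by (rule poly_eqI) (simp add: coeff_map_poly coeff_mult hom_sum hom_mult)

end

lemma field_embedding_to_ac: "field_embedding to_ac"
  by (auto simp: field_embedding_def field_extension_iff)

section \<open>Algebraic extensions and partial homomorphisms\<close>

locale algebraic_embedding = field_embedding i for i :: "'a::field \<Rightarrow> 'b::field" +
  assumes algebraic: "\<exists>p. p \<noteq> 0 \<and> poly (map_poly i p) x = 0"

lemma algebraic_embedding_to_ac: "algebraic_embedding to_ac"
  by (intro algebraic_embedding.intro field_embedding_to_ac algebraic_embedding_axioms.intro)
    (metis alg_closure_algebraic)

text \<open>Read \<open>p\<close> as a polynomial over the domain of a partial homomorphism with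
  graph \<open>R\<close>, and \<open>p'\<close> as its image. For a diagonal \<open>R\<close> this
  means that \<open>p = p'\<close> has its coefficients in a given set.\<close>

definition poly_rel :: "('b::zero \<times> 'c::zero) set \<Rightarrow> 'b poly \<Rightarrow> 'c poly \<Rightarrow> bool" where
  "poly_rel R p p' \<longleftrightarrow> (\<forall>n. (Polynomial.coeff p n, Polynomial.coeff p' n) \<in> R)"

locale two_embeddings = algebraic_embedding i + g: field_embedding g
  for i :: "'a::field \<Rightarrow> 'b::field" and g :: "'a \<Rightarrow> 'c::field"
begin

text \<open>
  A homomorphism over \<open>K\<close> from an intermediate ring of \<open>'b\<close> to \<open>'c\<close>, given by its graph. By
  algebraicity the domain is automatically a field.
\<close>
definition partial_hom :: "('b \<times> 'c) set \<Rightarrow> bool" where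
  "partial_hom R \<longleftrightarrow> (\<forall>k. (i k, g k) \<in> R) \<and>
     (\<forall>x y x' y'. (x, y) \<in> R \<longrightarrow> (x', y') \<in> R \<longrightarrow> (x + x', y + y') \<in> R \<and> (x * x', y * y') \<in> R) \<and>
     (\<forall>y. (0, y) \<in> R \<longrightarrow> y = 0)"

context
  fixes R
  assumes R: "partial_hom R"
begin

lemma partial_hom_base: "(i k, g k) \<in> R"
  and partial_hom_add: "(x, y) \<in> R \<Longrightarrow> (x', y') \<in> R \<Longrightarrow> (x + x', y + y') \<in> R"
  and partial_hom_mult: "(x, y) \<in> R \<Longrightarrow> (x', y') \<in> R \<Longrightarrow> (x * x', y * y') \<in> R"
  and partial_hom_zero_left: "(0, y) \<in> R \<Longrightarrow> y = 0"
  using R by (auto simp: partial_hom_def)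

lemma partial_hom_zero: "(0, 0) \<in> R" and partial_hom_one: "(1, 1) \<in> R"
  using partial_hom_base[of 0] partial_hom_base[of 1] by auto

lemma partial_hom_uminus: "(x, y) \<in> R \<Longrightarrow> (- x, - y) \<in> R"
  using partial_hom_mult[OF partial_hom_base[of "- 1"]] by (simp add: hom_uminus g.hom_uminus)

lemma partial_hom_diff: "(x, y) \<in> R \<Longrightarrow> (x', y') \<in> R \<Longrightarrow> (x - x', y - y') \<in> R"
  using partial_hom_add[OF _ partial_hom_uminus] by fastforce

text \<open>The difference of the two pairs is \<open>(0, y - y')\<close>, so the zero clause of
  \<open>partial_hom\<close> amounts to single-valuedness.\<close>

lemma partial_hom_unique: "(x, y) \<in> R \<Longrightarrow> (x, y') \<in> R \<Longrightarrow> y = y'"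
  using partial_hom_zero_left partial_hom_diff by fastforce

lemma partial_hom_sum: "(\<And>x. x \<in> A \<Longrightarrow> (f x, f' x) \<in> R) \<Longrightarrow> (sum f A, sum f' A) \<in> R"
  by (induction A rule: infinite_finite_induct) (auto simp: partial_hom_zero partial_hom_add)

lemma poly_rel_map_poly: "poly_rel R (map_poly i p) (map_poly g p)"
  by (auto simp: poly_rel_def coeff_map_poly partial_hom_base)

lemma poly_rel_add: "poly_rel R p p' \<Longrightarrow> poly_rel R q q' \<Longrightarrow> poly_rel R (p + q) (p' + q')"
  by (auto simp: poly_rel_def partial_hom_add)

lemma poly_rel_diff: "poly_rel R p p' \<Longrightarrow> poly_rel R q q' \<Longrightarrow> poly_rel R (p - q) (p' - q')"
  by (auto simp: poly_rel_def partial_hom_diff)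

lemma poly_rel_mult: "poly_rel R p p' \<Longrightarrow> poly_rel R q q' \<Longrightarrow> poly_rel R (p * q) (p' * q')"
  by (auto simp: poly_rel_def coeff_mult intro!: partial_hom_sum partial_hom_mult)

lemma poly_rel_monom: "(c, c') \<in> R \<Longrightarrow> poly_rel R (Polynomial.monom c n) (Polynomial.monom c' n)"
  by (auto simp: poly_rel_def partial_hom_zero)

lemma poly_rel_pCons: "poly_rel R (pCons a p) (pCons b q) \<longleftrightarrow> (a, b) \<in> R \<and> poly_rel R p q"
  unfolding poly_rel_def by (auto simp: coeff_pCons split: nat.splits)

lemma poly_rel_eval: "poly_rel R p p' \<Longrightarrow> (x, y) \<in> R \<Longrightarrow> (poly p x, poly p' y) \<in> R"
  by (induction p p' rule: poly_induct2)
    (auto simp: poly_rel_pCons partial_hom_zero partial_hom_add partial_hom_mult)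

text \<open>Since \<open>x\<close> is algebraic over K, \<open>inverse x\<close> is a polynomial in
  \<open>x\<close> over K and already lies in the domain.\<close>

lemma partial_hom_inverse:
  assumes xy: "(x, y) \<in> R"
  shows "(inverse x, inverse y) \<in> R"
proof (cases "x = 0")
  case True
  then have "y = 0" using xy partial_hom_zero_left by blast
  with True show ?thesis using partial_hom_zero by simp
next
  case False
  \<comment> \<open>Cancel powers of the variable from an annihilating polynomial, which is allowed
    because \<open>x \<noteq> 0\<close>.\<close>
  have "\<exists>p. Polynomial.coeff p 0 \<noteq> 0 \<and> poly (map_poly i p) x = 0"
  proof -
    obtain p where "p \<noteq> 0" "poly (map_poly i p) x = 0"
      using algebraic by blast
    then show ?thesis
    proof (induction p)
      case 0
      then show ?case by simp
    next
      case (pCons a p)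
      show ?case
      proof (cases "a = 0")
        case True
        with pCons False show ?thesis by (auto simp: map_poly_pCons)
      next
        case False
        with pCons.prems show ?thesis by (intro exI[of _ "pCons a p"]) auto
      qed
    qed
  qed
  then obtain p where p: "Polynomial.coeff p 0 \<noteq> 0" "poly (map_poly i p) x = 0" by blast
  obtain c r where cr: "p = pCons c r" by (cases p)
  \<comment> \<open>Solve \<open>i c + x * poly (map_poly i r) x = 0\<close> for the inverse of
    \<open>x\<close>; \<open>v\<close> is the same expression on the side of
    \<open>y\<close>.\<close>
  define u where "u = - inverse (i c) * poly (map_poly i r) x"
  define v where "v = - inverse (g c) * poly (map_poly g r) y"
  have c: "c \<noteq> 0" and root: "i c + x * poly (map_poly i r) x = 0"
    using p by (auto simp: cr map_poly_pCons)
  have uv: "(u, v) \<in> R"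
    using partial_hom_mult[OF partial_hom_base[of "- inverse c"]
        poly_rel_eval[OF poly_rel_map_poly xy, of r]]
    by (simp add: u_def v_def hom_uminus g.hom_uminus hom_inverse g.hom_inverse)
  have "x * poly (map_poly i r) x = - i c"
    using root by (simp add: eq_neg_iff_add_eq_0 add.commute)
  then have xu: "x * u = 1"
    using c by (simp add: u_def mult.left_commute[of x "inverse (i c)"])
  have "(1, y * v) \<in> R" using partial_hom_mult[OF xy uv] xu by simp
  then have "y * v = 1" using partial_hom_one partial_hom_unique by blast
  with xu uv show ?thesis by (simp add: inverse_unique)
qed

text \<open>Otherwise multiplication by the pair of inverses would give \<open>(1, 0)\<close>,
  against \<open>(1, 1)\<close>. Partial homomorphisms are thus injective.\<close>

lemma partial_hom_zero_right: "(x, 0) \<in> R \<Longrightarrow> x = 0"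
  using partial_hom_mult[OF _ partial_hom_inverse] partial_hom_one partial_hom_unique
  by (metis mult_zero_left right_inverse zero_neq_one)

text \<open>By injectivity, coefficients vanish on both sides at the same indices.\<close>

lemma poly_rel_degree:
  assumes "poly_rel R p p'"
  shows "Polynomial.degree p = Polynomial.degree p'"
proof -
  have "Polynomial.coeff p n = 0 \<longleftrightarrow> Polynomial.coeff p' n = 0" for n
    using assms partial_hom_zero_right partial_hom_zero_left unfolding poly_rel_def by metis
  then show ?thesis by (simp add: Polynomial.degree_def)
qed

text \<open>Up to a unit, \<open>q\<close> is the minimal polynomial of \<open>x\<close> over the
  domain of \<open>R\<close>, and \<open>q'\<close> is its image. Division by \<open>q\<close> is
  carried out on both sides at once, so that the quotients stay related.\<close>

lemma minimal_pair:
  obtains q q' where "poly_rel R q q'" "q \<noteq> 0" "poly q x = 0"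
    "\<And>p p'. poly_rel R p p' \<Longrightarrow> poly p x = 0 \<Longrightarrow> \<exists>s s'. poly_rel R s s' \<and> p = s * q \<and> p' = s' * q'"
proof -
  define P where "P = (\<lambda>(q, q'). poly_rel R q q' \<and> q \<noteq> 0 \<and> poly q x = 0)"
  obtain p where "p \<noteq> 0" "poly (map_poly i p) x = 0"
    using algebraic by blast
  then have "P (map_poly i p, map_poly g p)"
    by (auto simp: P_def poly_rel_map_poly map_poly_eq_0_iff)
  then obtain z where z: "P z" "\<And>w. P w \<Longrightarrow> Polynomial.degree (fst z) \<le> Polynomial.degree (fst w)"
    using ex_has_least_nat[of P _ "\<lambda>z. Polynomial.degree (fst z)"] by blast
  obtain q q' where zq: "z = (q, q')" by (cases z)
  have q: "poly_rel R q q'" "q \<noteq> 0" "poly q x = 0"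
    using z(1) by (auto simp: P_def zq)
  have min: "Polynomial.degree q \<le> Polynomial.degree p"
    if "poly_rel R p p'" "p \<noteq> 0" "poly p x = 0" for p p'
    using z(2)[of "(p, p')"] that by (auto simp: P_def zq)
  \<comment> \<open>Induction on a degree bound \<open>n\<close>. The disjunct \<open>p = 0\<close>
    is separate because the zero polynomial has degree 0; for \<open>n = 0\<close> it is the only
    case.\<close>
  have div: "\<exists>s s'. poly_rel R s s' \<and> p = s * q \<and> p' = s' * q'"
    if "poly_rel R p p'" "poly p x = 0" "p = 0 \<or> Polynomial.degree p < n" for p p' n
    using that
  proof (induction n arbitrary: p p')
    case (0 p p')
    then have "p = 0" by simp
    moreover have "p' = 0"
      using 0 by (auto simp: poly_rel_def poly_eq_iff intro: partial_hom_zero_left)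
    ultimately show ?case
      by (intro exI[of _ 0]) (auto simp: poly_rel_def partial_hom_zero)
  next
    case (Suc n p p')
    show ?case
    proof (cases "p = 0")
      case True
      then show ?thesis using Suc.IH[of p p'] Suc.prems by simp
    next
      case False
      define d where "d = Polynomial.degree p - Polynomial.degree q"
      have le: "Polynomial.degree q \<le> Polynomial.degree p"
        using min Suc.prems False by blast
      \<comment> \<open>One step of long division: the ratio of leading coefficients, read off at
        the same indices on both sides, cancels the leading term of \<open>p\<close>.\<close>
      define c where "c = Polynomial.coeff p (Polynomial.degree p) / Polynomial.coeff q (Polynomial.degree q)"
      define c' where "c' = Polynomial.coeff p' (Polynomial.degree p) / Polynomial.coeff q' (Polynomial.degree q)"
      have cc: "(c, c') \<in> R"
        using Suc.prems(1) q(1) unfolding c_def c'_def divide_inverse poly_rel_def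
        by (intro partial_hom_mult partial_hom_inverse) auto
      let ?t = "Polynomial.monom c d" and ?t' = "Polynomial.monom c' d"
      have t: "poly_rel R ?t ?t'" using cc by (rule poly_rel_monom)
      have "Polynomial.coeff (?t * q) (Polynomial.degree p) = Polynomial.coeff p (Polynomial.degree p)"
        using le q(2) by (simp add: coeff_monom_mult d_def c_def)
      then have "Polynomial.coeff (p - ?t * q) (Polynomial.degree p) = 0" by simp
      moreover have "Polynomial.degree (p - ?t * q) \<le> Polynomial.degree p"
      proof (rule degree_diff_le)
        show "Polynomial.degree (?t * q) \<le> Polynomial.degree p"
          using degree_mult_le[of ?t q] degree_monom_le[of c d] le by (simp add: d_def)
      qed simp
      ultimately have "p - ?t * q = 0 \<or> Polynomial.degree (p - ?t * q) < n"
        using eq_zero_or_degree_less[of "p - ?t * q" "Polynomial.degree p"] Suc.prems(3) False by auto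
      moreover have "poly_rel R (p - ?t * q) (p' - ?t' * q')"
        by (intro poly_rel_diff poly_rel_mult t q Suc.prems)
      ultimately obtain s s' where "poly_rel R s s'" "p - ?t * q = s * q" "p' - ?t' * q' = s' * q'"
        using Suc.IH[of "p - ?t * q" "p' - ?t' * q'"] Suc.prems(2) q(3) by auto
      then show ?thesis
        using poly_rel_add[OF _ t] by (intro exI[of _ "s + ?t"] exI[of _ "s' + ?t'"])
          (auto simp: algebra_simps diff_eq_eq)
    qed
  qed
  show thesis
    by (rule that[of q q'], fact, fact, fact) (use div in blast)
qed

text \<open>The new graph consists of the values at \<open>x\<close> and \<open>y\<close> of related
  polynomials; \<open>vanish\<close> is precisely its zero clause.\<close>

lemma partial_hom_adjoin:
  assumes vanish: "\<And>p p'. poly_rel R p p' \<Longrightarrow> poly p x = 0 \<Longrightarrow> poly p' y = 0"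
  obtains S where "partial_hom S" "R \<subseteq> S" "(x, y) \<in> S"
proof (rule that)
  let ?S = "{(poly p x, poly p' y) |p p'. poly_rel R p p'}"
  have const: "(a, b) \<in> ?S" if "(a, b) \<in> R" for a b
    using poly_rel_monom[OF that, of 0] by (force simp: poly_monom)
  show "R \<subseteq> ?S" using const by auto
  show "(x, y) \<in> ?S"
    using poly_rel_monom[OF partial_hom_one, of 1] by (force simp: poly_monom)
  show "partial_hom ?S"
    unfolding partial_hom_def
  proof (intro conjI allI impI)
    show "(i k, g k) \<in> ?S" for k using const partial_hom_base by blast
    show "z = 0" if "(0, z) \<in> ?S" for z using that vanish by auto
    fix u v u' v' assume "(u, v) \<in> ?S" "(u', v') \<in> ?S"
    then obtain p p' q q' where *: "poly_rel R p p'" "poly_rel R q q'"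
      "u = poly p x" "v = poly p' y" "u' = poly q x" "v' = poly q' y" by auto
    show "(u + u', v + v') \<in> ?S"
      using poly_rel_add[OF *(1,2)] * by (force simp: poly_add[symmetric] simp del: poly_add)
    show "(u * u', v * v') \<in> ?S"
      using poly_rel_mult[OF *(1,2)] * by (force simp: poly_mult[symmetric] simp del: poly_mult)
  qed
qed

end

text \<open>The starting point for embedding an extension: the isomorphism between the two copies of
  K.\<close>

lemma partial_hom_base_graph: "partial_hom (range (\<lambda>k. (i k, g k)))"
  unfolding partial_hom_def
  by (auto simp: hom_add[symmetric] g.hom_add[symmetric] hom_mult[symmetric] g.hom_mult[symmetric])
end

section \<open>Extension to the whole field by Zorn's lemma\<close>

locale embeddings_into_closed = two_embeddings i g
  for i :: "'a::field \<Rightarrow> 'b::field" and g :: "'a \<Rightarrow> 'c::alg_closed_field"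
begin

text \<open>A maximal extension \<open>M\<close> of \<open>R\<close> is total: the minimal
  polynomial of \<open>x\<close> over the domain of \<open>M\<close> has an image with some root
  \<open>y\<close>, and \<open>(x, y)\<close> can be adjoined.\<close>

lemma partial_hom_extend:
  assumes R: "partial_hom R"
  obtains h where "field_extension h" "\<And>x y. (x, y) \<in> R \<Longrightarrow> h x = y"
proof -
  define A where "A = {S. partial_hom S \<and> R \<subseteq> S}"
  have "\<exists>M\<in>A. \<forall>S\<in>A. M \<subseteq> S \<longrightarrow> S = M"
  proof (rule subset_Zorn_nonempty)
    show "A \<noteq> {}" using R by (auto simp: A_def)
    fix C assume C: "C \<noteq> {}" "subset.chain A C"
    then have *: "\<And>S. S \<in> C \<Longrightarrow> partial_hom S \<and> R \<subseteq> S"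
      and chain: "\<And>S T. S \<in> C \<Longrightarrow> T \<in> C \<Longrightarrow> S \<subseteq> T \<or> T \<subseteq> S"
      by (auto simp: subset_chain_def A_def)
    have "partial_hom (\<Union>C)"
      unfolding partial_hom_def
    proof (intro conjI allI impI)
      show "(i k, g k) \<in> \<Union>C" for k using C(1) * partial_hom_base by blast
      show "y = 0" if "(0, y) \<in> \<Union>C" for y using that * partial_hom_zero_left by blast
      fix x y x' y' assume "(x, y) \<in> \<Union>C" "(x', y') \<in> \<Union>C"
      \<comment> \<open>Two members of a chain are comparable, so the larger one contains both
        pairs.\<close>
      then obtain S where "S \<in> C" "(x, y) \<in> S" "(x', y') \<in> S" using chain by blast
      then show "(x + x', y + y') \<in> \<Union>C" "(x * x', y * y') \<in> \<Union>C"
        using * partial_hom_add partial_hom_mult by blast+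
    qed
    with C(1) * show "\<Union>C \<in> A" unfolding A_def by blast
  qed
  then obtain M where M: "partial_hom M" "R \<subseteq> M"
    and max: "\<And>S. partial_hom S \<Longrightarrow> M \<subseteq> S \<Longrightarrow> S = M"
    unfolding A_def by (auto dest: order_trans)
  have "\<exists>y. (x, y) \<in> M" for x
  proof -
    obtain q q' where q: "poly_rel M q q'" "q \<noteq> 0" "poly q x = 0"
      "\<And>p p'. poly_rel M p p' \<Longrightarrow> poly p x = 0 \<Longrightarrow> \<exists>s s'. poly_rel M s s' \<and> p = s * q \<and> p' = s' * q'"
      by (rule minimal_pair[OF M(1)]) blast
    \<comment> \<open>A nonzero polynomial with a root is not constant; \<open>q'\<close> has the
      same degree and hence a root in the closed field.\<close>
    have "Polynomial.degree q > 0"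
      using q(2,3) by (metis bot_nat_0.not_eq_extremum degree_0_id poly_const_conv poly_zero
        degree_eq_zeroE pCons_eq_0_iff)
    then obtain y where "poly q' y = 0"
      using alg_closed_imp_poly_has_root[of q'] poly_rel_degree[OF M(1) q(1)] by auto
    then have "poly p' y = 0" if "poly_rel M p p'" "poly p x = 0" for p p'
      using q(4)[OF that] by auto
    then obtain S where "partial_hom S" "M \<subseteq> S" "(x, y) \<in> S"
      using partial_hom_adjoin[OF M(1)] by blast
    then show ?thesis using max by blast
  qed
  then obtain h where h: "\<And>x. (x, h x) \<in> M" by metis
  have h_eq: "h x = y" if "(x, y) \<in> M" for x y
    using partial_hom_unique[OF M(1)] h that by blast
  show thesis
  proof (rule that)
    show "field_extension h"
      unfolding field_extension_iff
      using h_eq partial_hom_one[OF M(1)] partial_hom_add[OF M(1)] partial_hom_mult[OF M(1)] h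
      by blast
    show "h x = y" if "(x, y) \<in> R" for x y using h_eq M(2) that by blast
  qed
qed

end

section \<open>The absolute Galois group\<close>

abbreviation galois_group :: "('a::field alg_closure \<Rightarrow> 'a alg_closure) set" where
  "galois_group \<equiv> automorphisms_fixing (range to_ac)"

lemma automorphisms_fixing_iff:
  "\<sigma> \<in> automorphisms_fixing E \<longleftrightarrow> field_extension \<sigma> \<and> bij \<sigma> \<and> (\<forall>x\<in>E. \<sigma> x = x)"
  by (auto simp: automorphisms_fixing_def ring_iso_def field_extension_def)
    (auto simp: ring_of_type_algebra_def)

lemma id_automorphisms_fixing: "id \<in> automorphisms_fixing E"
  by (auto simp: automorphisms_fixing_iff field_extension_iff)

lemma comp_automorphisms_fixing:
  "\<sigma> \<in> automorphisms_fixing E \<Longrightarrow> \<tau> \<in> automorphisms_fixing E \<Longrightarrow> \<sigma> \<circ> \<tau> \<in> automorphisms_fixing E"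
  by (auto simp: automorphisms_fixing_iff field_extension_iff intro: bij_comp)

lemma inv_automorphisms_fixing:
  assumes "\<sigma> \<in> automorphisms_fixing E"
  shows "inv_into UNIV \<sigma> \<in> automorphisms_fixing E"
proof -
  have *: "bij \<sigma>" "field_extension \<sigma>" "\<And>x. x \<in> E \<Longrightarrow> \<sigma> x = x"
    using assms by (auto simp: automorphisms_fixing_iff)
  let ?\<tau> = "inv_into UNIV \<sigma>"
  have eq: "?\<tau> u = v" if "\<sigma> v = u" for u v
    using that *(1) by (metis bij_inv_eq_iff)
  have \<sigma>: "\<sigma> (?\<tau> u) = u" for u
    using *(1) by (metis bij_inv_eq_iff)
  show ?thesis
    unfolding automorphisms_fixing_iff field_extension_iff
    using * by (intro conjI allI ballI eq bij_imp_bij_inv) (auto simp: \<sigma> field_extension_iff)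
qed

lemma automorphisms_fixing_antimono: "E \<subseteq> F \<Longrightarrow> automorphisms_fixing F \<subseteq> automorphisms_fixing E"
  unfolding automorphisms_fixing_iff subset_iff by blast

lemma group_absolute_galois_group: "group (absolute_galois_group :: ('a::field alg_closure \<Rightarrow> _) monoid)"
proof (rule groupI)
  let ?G = "absolute_galois_group :: ('a alg_closure \<Rightarrow> _) monoid"
  show "\<exists>y\<in>carrier ?G. y \<otimes>\<^bsub>?G\<^esub> x = \<one>\<^bsub>?G\<^esub>" if "x \<in> carrier ?G" for x
    using that by (intro bexI[of _ "inv_into UNIV x"])
      (auto simp: absolute_galois_group_def inv_automorphisms_fixing,
        simp add: automorphisms_fixing_iff bij_is_inj)
qed (auto simp: absolute_galois_group_def comp_automorphisms_fixing id_automorphisms_fixing comp_assoc)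

lemma subgroup_automorphisms_fixing:
  fixes E :: "'a::field alg_closure set"
  assumes "range to_ac \<subseteq> E"
  shows "subgroup (automorphisms_fixing E) absolute_galois_group"
proof (rule group.subgroupI[OF group_absolute_galois_group])
  let ?G = "absolute_galois_group :: ('a alg_closure \<Rightarrow> _) monoid"
  have sub: "automorphisms_fixing E \<subseteq> galois_group"
    using automorphisms_fixing_antimono[OF assms] .
  then show "automorphisms_fixing E \<subseteq> carrier ?G"
    by (simp add: absolute_galois_group_def)
  show "automorphisms_fixing E \<noteq> {}"
    using id_automorphisms_fixing by blast
  show "a \<otimes>\<^bsub>?G\<^esub> b \<in> automorphisms_fixing E"
    if "a \<in> automorphisms_fixing E" "b \<in> automorphisms_fixing E" for a b
    using that by (simp add: absolute_galois_group_def comp_automorphisms_fixing)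
  show "inv\<^bsub>?G\<^esub> a \<in> automorphisms_fixing E" if a: "a \<in> automorphisms_fixing E" for a
  proof -
    have "inv\<^bsub>?G\<^esub> a = inv_into UNIV a"
    proof (rule group.inv_equality[OF group_absolute_galois_group])
      show "a \<in> carrier ?G" using a sub by (auto simp: absolute_galois_group_def)
      then show "inv_into UNIV a \<in> carrier ?G"
        using inv_automorphisms_fixing by (auto simp: absolute_galois_group_def)
      show "inv_into UNIV a \<otimes>\<^bsub>?G\<^esub> a = \<one>\<^bsub>?G\<^esub>"
        using a by (auto simp: absolute_galois_group_def automorphisms_fixing_iff bij_is_inj)
    qed
    then show ?thesis using inv_automorphisms_fixing[OF a] by simp
  qed
qed

text \<open>The stabilizer is the coset of \<open>id\<close>, hence itself a basic open set.\<close>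

lemma openin_automorphisms_fixing:
  fixes E :: "'a::field alg_closure set"
  assumes "finite_subextension E"
  shows "openin krull_topology (automorphisms_fixing E)"
proof -
  have "automorphisms_fixing E = id <#\<^bsub>absolute_galois_group\<^esub> automorphisms_fixing E"
    by (auto simp: l_coset_def absolute_galois_group_def)
  then show ?thesis
    unfolding krull_topology_def openin_topology_generated_by_iff
    using assms by (intro generate_topology_on.Basis)
      (auto simp: absolute_galois_group_def id_automorphisms_fixing intro!: exI[of _ id] exI[of _ E])
qed

text \<open>If \<open>\<sigma> = h \<circ> \<tau>\<close>, the inverse of \<open>\<sigma>\<close> is
  that of \<open>\<tau>\<close> after that of \<open>h\<close>, and \<open>h\<close> fixes
  \<open>E\<close>. Right cosets therefore correspond to the restrictions to \<open>E\<close> of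
  inverses, not of the automorphisms themselves.\<close>

lemma rcoset_eq_iff:
  fixes E :: "'a::field alg_closure set"
  assumes E: "range to_ac \<subseteq> E" and \<sigma>: "\<sigma> \<in> galois_group" and \<tau>: "\<tau> \<in> galois_group"
  shows "automorphisms_fixing E #>\<^bsub>absolute_galois_group\<^esub> \<sigma> =
      automorphisms_fixing E #>\<^bsub>absolute_galois_group\<^esub> \<tau> \<longleftrightarrow>
    (\<forall>x\<in>E. inv_into UNIV \<sigma> x = inv_into UNIV \<tau> x)" (is "?H #>\<^bsub>?G\<^esub> \<sigma> = _ \<longleftrightarrow> _")
proof
  have bij: "bij \<sigma>" "bij \<tau>" using \<sigma> \<tau> by (auto simp: automorphisms_fixing_iff)
  assume "?H #>\<^bsub>?G\<^esub> \<sigma> = ?H #>\<^bsub>?G\<^esub> \<tau>"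
  moreover have "\<sigma> \<in> ?H #>\<^bsub>?G\<^esub> \<sigma>"
    by (rule group.rcos_self[OF group_absolute_galois_group _ subgroup_automorphisms_fixing[OF E]])
      (use \<sigma> in \<open>simp add: absolute_galois_group_def\<close>)
  ultimately obtain h where h: "h \<in> ?H" "\<sigma> = h \<circ> \<tau>"
    by (auto simp: r_coset_def absolute_galois_group_def)
  have "inv_into UNIV \<sigma> x = inv_into UNIV \<tau> x" if "x \<in> E" for x
  proof -
    have "\<sigma> (inv_into UNIV \<tau> x) = h x"
      using bij(2) by (simp add: h(2) bij_is_surj surj_f_inv_f)
    also have "\<dots> = x" using h(1) that by (auto simp: automorphisms_fixing_iff)
    finally show ?thesis using bij(1) by (metis bij_inv_eq_iff)
  qed
  then show "\<forall>x\<in>E. inv_into UNIV \<sigma> x = inv_into UNIV \<tau> x" by blast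
next
  have bij: "bij \<sigma>" "bij \<tau>" using \<sigma> \<tau> by (auto simp: automorphisms_fixing_iff)
  assume *: "\<forall>x\<in>E. inv_into UNIV \<sigma> x = inv_into UNIV \<tau> x"
  \<comment> \<open>The only \<open>h\<close> with \<open>\<tau> = h \<circ> \<sigma>\<close>;
    agreement of the inverses on \<open>E\<close> makes it fix \<open>E\<close>.\<close>
  define h where "h = \<tau> \<circ> inv_into UNIV \<sigma>"
  have "h \<in> galois_group"
    unfolding h_def by (intro comp_automorphisms_fixing inv_automorphisms_fixing \<sigma> \<tau>)
  moreover have "h x = x" if "x \<in> E" for x
    using * that bij(2) by (simp add: h_def bij_is_surj surj_f_inv_f)
  ultimately have "h \<in> ?H" by (auto simp: automorphisms_fixing_iff)
  moreover have "\<tau> = h \<circ> \<sigma>" using bij(1) by (auto simp: h_def fun_eq_iff bij_is_inj)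
  ultimately have "\<tau> \<in> ?H #>\<^bsub>?G\<^esub> \<sigma>"
    by (auto simp: r_coset_def absolute_galois_group_def)
  then show "?H #>\<^bsub>?G\<^esub> \<sigma> = ?H #>\<^bsub>?G\<^esub> \<tau>"
    by (rule group.repr_independence[OF group_absolute_galois_group _ _ subgroup_automorphisms_fixing[OF E]])
      (use \<sigma> in \<open>simp add: absolute_galois_group_def\<close>)
qed

section \<open>Automorphisms and fixed fields of the algebraic closure\<close>

lemma endomorphism_alg_closure_bij:
  fixes h :: "'a::field alg_closure \<Rightarrow> 'a alg_closure"
  assumes h: "field_extension h" and fix_base: "\<And>k. h (to_ac k) = to_ac k"
  shows "bij h"
proof -
  interpret h: field_embedding h by unfold_locales (rule h)
  have inj: "inj h" by (auto simp: inj_def)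
  have "y \<in> range h" for y
  proof -
    obtain p :: "'a poly" where p: "p \<noteq> 0" "poly (map_poly to_ac p) y = 0"
      using alg_closure_algebraic[of y] by blast
    \<comment> \<open>The roots of a polynomial over K form a finite set that \<open>h\<close> maps
      injectively into itself, hence onto itself.\<close>
    define Z where "Z = {z. poly (map_poly to_ac p) z = 0}"
    have "finite Z"
      unfolding Z_def using p(1) by (intro poly_roots_finite) (simp add: map_poly_eq_0_iff)
    moreover have "h ` Z \<subseteq> Z"
    proof
      fix w assume "w \<in> h ` Z"
      then obtain z where z: "poly (map_poly to_ac p) z = 0" "w = h z" by (auto simp: Z_def)
      have "map_poly h (map_poly to_ac p) = map_poly to_ac p"
        by (rule poly_eqI) (simp add: coeff_map_poly fix_base)
      with h.hom_poly[of "map_poly to_ac p" z] z show "w \<in> Z" by (simp add: Z_def)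
    qed
    ultimately have "h ` Z = Z"
      using inj by (intro endo_inj_surj) (auto intro: inj_on_subset)
    moreover have "y \<in> Z" using p(2) by (simp add: Z_def)
    ultimately show ?thesis by blast
  qed
  with inj show ?thesis by (auto simp: bij_def)
qed

text \<open>A nonzero annihilator of least degree is irreducible: in any factorization one factor
  annihilates \<open>x\<close>, so it has full degree and the other factor is constant.\<close>

lemma exists_irreducible_annihilator:
  assumes "algebraic_embedding (i :: 'a::field \<Rightarrow> 'b::field)"
  obtains p where "Factorial_Ring.irreducible p" "poly (map_poly i p) x = 0"
proof -
  interpret algebraic_embedding i by fact
  define P where "P = (\<lambda>p. p \<noteq> 0 \<and> poly (map_poly i p) x = 0)"
  obtain p where p: "P p" "\<And>q. P q \<Longrightarrow> Polynomial.degree p \<le> Polynomial.degree q"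
    using algebraic[of x] ex_has_least_nat[of P _ Polynomial.degree] unfolding P_def by metis
  have unit: "b dvd 1" if "p = a * b" "P a" for a b
  proof -
    have nz: "a \<noteq> 0" "b \<noteq> 0" using p(1) that(1) by (auto simp: P_def)
    then have "Polynomial.degree p = Polynomial.degree a + Polynomial.degree b"
      using that(1) by (simp add: degree_mult_eq)
    then have "Polynomial.degree b = 0" using p(2)[OF that(2)] by simp
    then show ?thesis using nz(2) by (simp add: is_unit_iff_degree)
  qed
  have "Factorial_Ring.irreducible p"
  proof (rule Factorial_Ring.irreducibleI)
    show "p \<noteq> 0" using p(1) by (simp add: P_def)
    show "\<not> p dvd 1"
    proof
      assume "p dvd 1"
      then obtain c where "p = [:c:]" by (auto simp: is_unit_poly_iff)
      with p(1) show False by (simp add: P_def map_poly_pCons)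
    qed
    fix a b assume ab: "p = a * b"
    then have "P a \<or> P b" using p(1) by (auto simp: P_def map_poly_mult)
    then show "a dvd 1 \<or> b dvd 1" using unit ab by (metis mult.commute)
  qed
  then show thesis using that p(1) by (auto simp: P_def)
qed

text \<open>Separability supplies a conjugate \<open>y \<noteq> x\<close> of any \<open>x\<close> outside \<open>F\<close>.\<close>
lemma fixed_field:
  fixes F :: "'a::field alg_closure set"
  assumes perfect: "perfect_field TYPE('a)" and base: "range to_ac \<subseteq> F"
    and add: "\<And>x y. x \<in> F \<Longrightarrow> y \<in> F \<Longrightarrow> x + y \<in> F"
    and mult: "\<And>x y. x \<in> F \<Longrightarrow> y \<in> F \<Longrightarrow> x * y \<in> F"
    and fixed: "\<And>\<sigma>. \<sigma> \<in> automorphisms_fixing F \<Longrightarrow> \<sigma> x = x"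
  shows "x \<in> F"
proof (rule ccontr)
  assume x: "x \<notin> F"
  interpret embeddings_into_closed "to_ac :: 'a \<Rightarrow> _" "to_ac :: 'a \<Rightarrow> _"
    by (intro embeddings_into_closed.intro two_embeddings.intro
        algebraic_embedding_to_ac field_embedding_to_ac)
  \<comment> \<open>The identity on \<open>F\<close> as a partial homomorphism, so that
    \<open>q\<close> below is, up to a unit, the minimal polynomial of \<open>x\<close> over
    \<open>F\<close>.\<close>
  define R where "R = {(z, z) |z. z \<in> F}"
  have R: "partial_hom R"
    using base add mult by (auto simp: partial_hom_def R_def)
  have rel_eq: "p = p'" if "poly_rel R p p'" for p p'
    using that by (auto simp: poly_rel_def R_def poly_eq_iff)
  obtain q q' where q: "poly_rel R q q'" "q \<noteq> 0" "poly q x = 0"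
    "\<And>p p'. poly_rel R p p' \<Longrightarrow> poly p x = 0 \<Longrightarrow> \<exists>s s'. poly_rel R s s' \<and> p = s * q \<and> p' = s' * q'"
    by (rule minimal_pair[OF R]) blast
  have "q' = q" using rel_eq[OF q(1)] by (rule sym)
  obtain r where r: "q = [:- x, 1:] * r"
    using q(3) by (auto simp: poly_eq_0_iff_dvd)
  \<comment> \<open>If \<open>q\<close> were linear, its coefficients would force \<open>x\<close>
    into \<open>F\<close>.\<close>
  have "Polynomial.degree r > 0"
  proof (rule ccontr)
    assume "\<not> Polynomial.degree r > 0"
    then obtain c where "r = [:c:]" by (metis degree_eq_zeroE gr0I)
    then have qc: "q = [:- x * c, c:]" and c: "c \<noteq> 0" using r q(2) by auto
    have coeffs: "(Polynomial.coeff q n, Polynomial.coeff q n) \<in> R" for n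
      using q(1) \<open>q' = q\<close> by (simp add: poly_rel_def)
    have "(- x * c, - x * c) \<in> R" "(c, c) \<in> R"
      using coeffs[of 0] coeffs[of 1] by (simp_all add: qc)
    then have "(- x * c * inverse c, - x * c * inverse c) \<in> R"
      using partial_hom_mult[OF R _ partial_hom_inverse[OF R]] by blast
    then have "(- x, - x) \<in> R" using c by (simp add: mult.assoc)
    from partial_hom_uminus[OF R this] show False using x by (simp add: R_def)
  qed
  then obtain y where y: "poly r y = 0" using alg_closed_imp_poly_has_root by blast
  \<comment> \<open>Otherwise \<open>x\<close> is a double root of \<open>q\<close>. But
    \<open>q\<close> divides an irreducible polynomial over K, which has no repeated root because K
    is perfect.\<close>
  have "y \<noteq> x"
  proof
    assume "y = x"
    then have "[:- x, 1:] ^ 2 dvd q"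
      unfolding r power2_eq_square using y by (intro mult_dvd_mono) (simp_all add: poly_eq_0_iff_dvd)
    obtain p :: "'a poly" where p: "Factorial_Ring.irreducible p" "poly (map_poly to_ac p) x = 0"
      using exists_irreducible_annihilator[OF algebraic_embedding_to_ac, of x] by blast
    then have "q dvd map_poly to_ac p"
      using q(4)[OF poly_rel_map_poly[OF R]] by fastforce
    with \<open>[:- x, 1:] ^ 2 dvd q\<close> have "[:- x, 1:] ^ 2 dvd map_poly to_ac p" by (rule dvd_trans)
    moreover have "rsquarefree (map_poly to_ac p)"
      using perfect p(1) by (auto simp: perfect_field_def separable_poly_def)
    then have "map_poly to_ac p \<noteq> 0" "Polynomial.order x (map_poly to_ac p) \<le> 1"
      unfolding rsquarefree_def by (auto, metis le_refl zero_le_one One_nat_def)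
    ultimately show False by (auto simp: order_divides)
  qed
  \<comment> \<open>Sending \<open>x\<close> to the other root \<open>y\<close> of \<open>q\<close>
    extends the identity of \<open>F\<close>, first to \<open>F(x)\<close> and then to an
    automorphism of Kbar that moves \<open>x\<close>.\<close>
  have "poly p' y = 0" if "poly_rel R p p'" "poly p x = 0" for p p'
    using q(4)[OF that] y by (auto simp: \<open>q' = q\<close> r)
  then obtain S where S: "partial_hom S" "R \<subseteq> S" "(x, y) \<in> S"
    using partial_hom_adjoin[OF R] by blast
  obtain h where h: "field_extension h" "\<And>u v. (u, v) \<in> S \<Longrightarrow> h u = v"
    using partial_hom_extend[OF S(1)] by blast
  have hF: "h z = z" if "z \<in> F" for z
    using h(2)[of z z] S(2) that by (auto simp: R_def)
  moreover have "bij h"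
    using endomorphism_alg_closure_bij[OF h(1)] hF base by blast
  ultimately have "h \<in> automorphisms_fixing F"
    using h(1) by (auto simp: automorphisms_fixing_iff)
  then have "h x = x" by (rule fixed)
  with h(2)[OF S(3)] \<open>y \<noteq> x\<close> show False by simp
qed

section \<open>Adjoining \<open>m\<close>-th roots\<close>

text \<open>These are the roots of \<open>X^m - c\<close>, which is nonzero because
  \<open>m \<ge> 1\<close>.\<close>

lemma nth_roots_bound:
  fixes c :: "'a::field"
  assumes "m \<ge> 1"
  shows "finite {y. y ^ m = c}" "card {y. y ^ m = c} \<le> m"
proof -
  define p where "p = Polynomial.monom 1 m - [:c:]"
  have "Polynomial.coeff p m = 1"
    using assms by (simp add: p_def coeff_pCons split: nat.split)
  then have p: "p \<noteq> 0" by auto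
  have set: "{y. y ^ m = c} = {y. poly p y = 0}" by (simp add: p_def poly_monom)
  have "Polynomial.degree p \<le> m"
    unfolding p_def by (intro degree_diff_le degree_monom_le) simp
  with p show "finite {y. y ^ m = c}" "card {y. y ^ m = c} \<le> m"
    unfolding set using poly_roots_finite[OF p] card_poly_roots_bound[OF p] by auto
qed

text \<open>Transfers finiteness and cardinality bounds: the image of \<open>g\<close> on
  \<open>A\<close> becomes an image of the image of \<open>f\<close>.\<close>

lemma factor_through:
  assumes "\<And>x y. x \<in> A \<Longrightarrow> y \<in> A \<Longrightarrow> f x = f y \<Longrightarrow> g x = g y"
  shows "\<exists>h. \<forall>x\<in>A. g x = h (f x)"
  using assms function_factors_left_gen[of "\<lambda>x. x \<in> A" f g] by metis

section \<open>Finite extensions inside the algebraic closure\<close>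

context field_embedding
begin

lemma module_scale: "Modules.module (\<lambda>c x. i c * x)"
  by unfold_locales (simp_all add: hom_add hom_mult distrib_left distrib_right mult.assoc)

lemma span_over_finite:
  assumes "finite B" "x \<in> span_over i B"
  obtains c where "x = (\<Sum>b\<in>B. i (c b) * b)"
  using assms Modules.module.span_finite[OF module_scale assms(1)] by (auto simp: span_over_def)

end

text \<open>The tower K, L, Kbar. As L lives in its own type, its copy inside Kbar is
  \<open>range j\<close>.\<close>

locale finite_intermediate_field = i: field_embedding i + field_embedding j
  for i :: "'a::field \<Rightarrow> 'b::field" and j :: "'b \<Rightarrow> 'a alg_closure" +
  fixes B
  assumes over_base: "j (i k) = to_ac k"
    and finite_B: "finite B" and span_B: "span_over i B = UNIV"
begin

lemma expand_in_B:
  obtains c where "x = (\<Sum>b\<in>B. i (c b) * b)"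
  using i.span_over_finite[OF finite_B, of x] span_B by blast

lemma range_to_ac_subset: "range to_ac \<subseteq> range j"
proof
  fix x assume "x \<in> range (to_ac :: 'a \<Rightarrow> _)"
  then obtain k where "x = to_ac k" by (rule rangeE)
  then have "x = j (i k)" by (simp only: over_base)
  then show "x \<in> range j" by (rule range_eqI)
qed

text \<open>Polynomial values suffice, since \<open>L[\<alpha>] = L(\<alpha>)\<close> for algebraic
  \<open>\<alpha>\<close>.\<close>

definition adjoin :: "'a alg_closure \<Rightarrow> 'a alg_closure set" where
  "adjoin \<alpha> = range (\<lambda>p. poly (map_poly j p) \<alpha>)"

lemma adjoin_base: "j l \<in> adjoin \<alpha>"
proof -
  have "j l = poly (map_poly j [:l:]) \<alpha>" by (simp add: map_poly_pCons)
  then show ?thesis unfolding adjoin_def by (rule range_eqI)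
qed

lemma adjoin_gen: "\<alpha> \<in> adjoin \<alpha>"
proof -
  have "\<alpha> = poly (map_poly j [:0, 1:]) \<alpha>" by (simp add: map_poly_pCons)
  then show ?thesis unfolding adjoin_def by (rule range_eqI)
qed

lemma adjoin_add: "x \<in> adjoin \<alpha> \<Longrightarrow> y \<in> adjoin \<alpha> \<Longrightarrow> x + y \<in> adjoin \<alpha>"
proof -
  assume "x \<in> adjoin \<alpha>" "y \<in> adjoin \<alpha>"
  then obtain p q where "x = poly (map_poly j p) \<alpha>" "y = poly (map_poly j q) \<alpha>"
    by (auto simp: adjoin_def)
  then have "x + y = poly (map_poly j (p + q)) \<alpha>" by (simp add: map_poly_add)
  then show ?thesis by (simp add: adjoin_def)
qed

lemma adjoin_mult: "x \<in> adjoin \<alpha> \<Longrightarrow> y \<in> adjoin \<alpha> \<Longrightarrow> x * y \<in> adjoin \<alpha>"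
proof -
  assume "x \<in> adjoin \<alpha>" "y \<in> adjoin \<alpha>"
  then obtain p q where "x = poly (map_poly j p) \<alpha>" "y = poly (map_poly j q) \<alpha>"
    by (auto simp: adjoin_def)
  then have "x * y = poly (map_poly j (p * q)) \<alpha>" by (simp add: map_poly_mult)
  then show ?thesis by (simp add: adjoin_def)
qed

lemma adjoin_power: "x \<in> adjoin \<alpha> \<Longrightarrow> x ^ n \<in> adjoin \<alpha>"
proof (induction n)
  case 0
  show ?case using adjoin_base[of 1] by simp
next
  case (Suc n)
  then show ?case by (simp add: adjoin_mult)
qed

lemma range_to_ac_subset_adjoin: "range to_ac \<subseteq> adjoin \<alpha>"
proof (rule subset_trans[OF range_to_ac_subset])
  show "range j \<subseteq> adjoin \<alpha>" using adjoin_base by blast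
qed

lemma to_ac_in_adjoin: "to_ac k \<in> adjoin \<alpha>"
  using range_to_ac_subset_adjoin by (rule subsetD) (rule rangeI)

text \<open>A ring between K and Kbar is a field by algebraicity: apply
  \<open>partial_hom_inverse\<close> to the identity on it.\<close>

lemma adjoin_inverse:
  assumes "x \<in> adjoin \<alpha>"
  shows "inverse x \<in> adjoin \<alpha>"
proof -
  interpret two_embeddings "to_ac :: 'a \<Rightarrow> _" "to_ac :: 'a \<Rightarrow> _"
    by (intro two_embeddings.intro algebraic_embedding_to_ac field_embedding_to_ac)
  have "partial_hom {(z, z) |z. z \<in> adjoin \<alpha>}"
    by (auto simp: partial_hom_def adjoin_add adjoin_mult to_ac_in_adjoin)
  from partial_hom_inverse[OF this] assms show ?thesis by blast
qed

lemma subfield_adjoin: "subfield (adjoin \<alpha>) (ring_of_type_algebra :: 'a alg_closure ring)"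
proof -
  let ?A = "ring_of_type_algebra :: 'a alg_closure ring"
  interpret A: field ?A by (rule field_from_type_algebra)
  have [simp]: "carrier ?A = UNIV" "\<one>\<^bsub>?A\<^esub> = 1" "\<zero>\<^bsub>?A\<^esub> = 0"
    "x \<oplus>\<^bsub>?A\<^esub> y = x + y" "x \<otimes>\<^bsub>?A\<^esub> y = x * y" for x y
    by (auto simp: ring_of_type_algebra_def)
  have minus: "\<ominus>\<^bsub>?A\<^esub> x = - x" for x
    by (rule A.minus_equality) auto
  show ?thesis
  proof (rule A.subfieldI'[OF A.subringI])
    show "\<ominus>\<^bsub>?A\<^esub> x \<in> adjoin \<alpha>" if "x \<in> adjoin \<alpha>" for x
      using adjoin_mult[OF adjoin_base[of "- 1"] that] by (simp add: minus hom_uminus)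
    show "inv\<^bsub>?A\<^esub> x \<in> adjoin \<alpha>" if "x \<in> adjoin \<alpha> - {\<zero>\<^bsub>?A\<^esub>}" for x
    proof -
      have "inv\<^bsub>?A\<^esub> x = inverse x"
        by (rule A.comm_inv_char) (use that in auto)
      with that adjoin_inverse show ?thesis by auto
    qed
  qed (use adjoin_base[of 1] in \<open>auto simp: adjoin_add adjoin_mult\<close>)
qed

text \<open>The monomials \<open>b \<alpha>\<^sup>k\<close> with \<open>b \<in> B\<close> and \<open>k < m\<close> span \<open>L(\<alpha>)\<close>.\<close>
lemma finite_subextension_adjoin:
  assumes m: "m \<ge> 1" and \<alpha>: "\<alpha> ^ m = j a"
  shows "finite_subextension (adjoin \<alpha>)"
proof -
  interpret ac: field_embedding "to_ac :: 'a \<Rightarrow> _" by (rule field_embedding_to_ac)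
  interpret V: Modules.module "\<lambda>c x. to_ac c * x :: 'a alg_closure" by (rule ac.module_scale)
  define B' where "B' = (\<lambda>(b, k). j b * \<alpha> ^ k) ` (B \<times> {..<m})"
  have "finite B'" by (simp add: B'_def finite_B)
  have "V.span B' \<subseteq> adjoin \<alpha>"
  proof (rule V.span_minimal)
    show "B' \<subseteq> adjoin \<alpha>"
      by (auto simp: B'_def intro!: adjoin_mult adjoin_base adjoin_power adjoin_gen)
    show "V.subspace (adjoin \<alpha>)"
      using adjoin_base[of 0] by (simp add: V.subspace_def adjoin_add adjoin_mult to_ac_in_adjoin)
  qed
  moreover have "adjoin \<alpha> \<subseteq> V.span B'"
  proof -
    have small: "j l * \<alpha> ^ k \<in> V.span B'" if k: "k < m" for l k
    proof -
      obtain c where l: "l = (\<Sum>b\<in>B. i (c b) * b)" by (rule expand_in_B)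
      have "j l * \<alpha> ^ k = (\<Sum>b\<in>B. to_ac (c b) * (j b * \<alpha> ^ k))"
        by (simp add: l hom_sum hom_mult over_base sum_distrib_right mult.assoc)
      also have "\<dots> \<in> V.span B'"
        by (intro V.span_sum V.span_scale V.span_base) (use k in \<open>auto simp: B'_def\<close>)
      finally show ?thesis .
    qed
    have "j l * \<alpha> ^ n \<in> V.span B'" for l n
    proof -
      \<comment> \<open>Reduce the exponent modulo \<open>m\<close> by means of
        \<open>\<alpha> ^ m = j a\<close>; the powers of \<open>a\<close> are absorbed into the
        coefficient from L.\<close>
      have "\<alpha> ^ n = (\<alpha> ^ m) ^ (n div m) * \<alpha> ^ (n mod m)"
        by (simp flip: power_mult power_add)
      then have "j l * \<alpha> ^ n = j (l * a ^ (n div m)) * \<alpha> ^ (n mod m)"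
        by (simp add: \<alpha> hom_mult hom_power mult.assoc)
      with small[of "n mod m"] m show ?thesis by simp
    qed
    then show ?thesis
      by (auto simp: adjoin_def poly_altdef coeff_map_poly intro!: V.span_sum)
  qed
  ultimately show ?thesis
    unfolding finite_subextension_def span_over_def
    using subfield_adjoin range_to_ac_subset_adjoin \<open>finite B'\<close> by blast
qed

section \<open>Embeddings of L, the index of stabilizers and power classes\<close>

lemma adjoin_eqI:
  assumes "field_extension \<sigma>" "field_extension \<tau>"
    and "\<And>l. \<sigma> (j l) = \<tau> (j l)" "\<sigma> \<alpha> = \<tau> \<alpha>" "x \<in> adjoin \<alpha>"
  shows "\<sigma> x = \<tau> x"
proof -
  interpret \<sigma>: field_embedding \<sigma> by unfold_locales fact
  interpret \<tau>: field_embedding \<tau> by unfold_locales fact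
  obtain p where p: "x = poly (map_poly j p) \<alpha>" using assms(5) by (auto simp: adjoin_def)
  have "map_poly \<sigma> (map_poly j p) = map_poly \<tau> (map_poly j p)"
    by (rule poly_eqI) (simp add: coeff_map_poly assms(3))
  then show ?thesis by (simp add: p \<sigma>.hom_poly \<tau>.hom_poly assms(4))
qed

text \<open>An embedding of L over K is determined by its values on the finite set \<open>B\<close>,
  and the value at \<open>b\<close> is a root of a fixed polynomial over K.\<close>

lemma finite_embeddings: "finite ((\<lambda>\<sigma> l. \<sigma> (j l)) ` (galois_group :: ('a alg_closure \<Rightarrow> _) set))"
proof -
  have "\<exists>p :: 'a poly. p \<noteq> 0 \<and> poly (map_poly to_ac p) x = 0" for x :: "'a alg_closure"
    using alg_closure_algebraic by metis
  then obtain P :: "'a alg_closure \<Rightarrow> 'a poly"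
    where P: "\<And>x. P x \<noteq> 0" "\<And>x. poly (map_poly to_ac (P x)) x = 0" by metis
  define Z where "Z b = {z. poly (map_poly to_ac (P (j b))) z = 0}" for b
  have Z: "finite (Z b)" for b
    unfolding Z_def using P(1) by (intro poly_roots_finite) (simp add: map_poly_eq_0_iff)
  define r where "r u = restrict u B" for u :: "'b \<Rightarrow> 'a alg_closure"
  let ?U = "(\<lambda>\<sigma> l. \<sigma> (j l)) ` (galois_group :: ('a alg_closure \<Rightarrow> _) set)"
  show ?thesis
  proof (rule finite_imageD)
    show "finite (r ` ?U)"
    proof (rule finite_subset)
      show "finite (PiE B Z)" using finite_B Z by (intro finite_PiE)
      have "\<sigma> (j b) \<in> Z b" if "\<sigma> \<in> galois_group" for \<sigma> b
      proof -
        interpret \<sigma>: field_embedding \<sigma>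
          by unfold_locales (use that in \<open>simp add: automorphisms_fixing_iff\<close>)
        have "map_poly \<sigma> (map_poly to_ac (P (j b))) = map_poly to_ac (P (j b))"
          by (rule poly_eqI) (use that in \<open>simp add: coeff_map_poly automorphisms_fixing_iff\<close>)
        then show ?thesis
          using \<sigma>.hom_poly[of "map_poly to_ac (P (j b))" "j b"] P(2) by (simp add: Z_def)
      qed
      then show "r ` ?U \<subseteq> PiE B Z" by (auto simp: r_def)
    qed
    show "inj_on r ?U"
    proof (rule inj_onI)
      fix u v assume "u \<in> ?U" "v \<in> ?U" and eq: "r u = r v"
      then obtain \<sigma> \<tau> where \<sigma>\<tau>: "\<sigma> \<in> galois_group" "\<tau> \<in> galois_group"
        "u = (\<lambda>l. \<sigma> (j l))" "v = (\<lambda>l. \<tau> (j l))" by auto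
      interpret \<sigma>: field_embedding \<sigma>
        by unfold_locales (use \<sigma>\<tau> in \<open>simp add: automorphisms_fixing_iff\<close>)
      interpret \<tau>: field_embedding \<tau>
        by unfold_locales (use \<sigma>\<tau> in \<open>simp add: automorphisms_fixing_iff\<close>)
      have eq': "\<sigma> (j b) = \<tau> (j b)" if "b \<in> B" for b
        using fun_cong[OF eq, of b] that by (simp add: r_def \<sigma>\<tau>)
      have "\<sigma> (j l) = \<tau> (j l)" for l
      proof -
        obtain c where l: "l = (\<Sum>b\<in>B. i (c b) * b)" by (rule expand_in_B)
        show ?thesis
          using \<sigma>\<tau>(1,2) by (simp add: l hom_sum hom_mult over_base \<sigma>.hom_sum \<sigma>.hom_mult
              \<tau>.hom_sum \<tau>.hom_mult automorphisms_fixing_iff eq')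
      qed
      then show "u = v" by (simp add: \<sigma>\<tau>)
    qed
  qed
qed

text \<open>Independent of \<open>\<alpha>\<close> and \<open>a\<close>, which makes the index bound
  below uniform.\<close>

definition num_embeddings :: nat where
  "num_embeddings = card ((\<lambda>\<sigma> l. \<sigma> (j l)) ` (galois_group :: ('a alg_closure \<Rightarrow> _) set))"

text \<open>
  A right coset of the stabilizer of \<open>L(\<alpha>)\<close> is determined by the images under inverses of \<open>L\<close>
  and of \<open>\<alpha>\<close>; the latter is an \<open>m\<close>-th root of the image of \<open>a\<close>.
\<close>
lemma index_adjoin_le:
  assumes m: "m \<ge> 1" and \<alpha>: "\<alpha> ^ m = j a"
  shows "finite (rcosets\<^bsub>absolute_galois_group\<^esub> (automorphisms_fixing (adjoin \<alpha>)))" (is "finite ?C")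
    and "card (rcosets\<^bsub>absolute_galois_group\<^esub> (automorphisms_fixing (adjoin \<alpha>))) \<le> num_embeddings * m"
proof -
  let ?G = "galois_group :: ('a alg_closure \<Rightarrow> _) set"
  let ?coset = "\<lambda>\<tau>. automorphisms_fixing (adjoin \<alpha>) #>\<^bsub>absolute_galois_group\<^esub> \<tau>"
  define \<Phi> where "\<Phi> \<tau> = ((\<lambda>l. inv_into UNIV \<tau> (j l)), inv_into UNIV \<tau> \<alpha>)" for \<tau> :: "'a alg_closure \<Rightarrow> _"
  let ?U = "(\<lambda>\<sigma> l. \<sigma> (j l)) ` ?G"
  let ?T = "SIGMA u:?U. {y. y ^ m = u a}"
  have C: "?C = ?coset ` ?G"
    by (auto simp: RCOSETS_def absolute_galois_group_def)
  have "\<Phi> ` ?G \<subseteq> ?T"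
  proof
    fix t assume "t \<in> \<Phi> ` ?G"
    then obtain \<tau> where \<tau>: "\<tau> \<in> ?G" "t = \<Phi> \<tau>" by blast
    then have inv: "inv_into UNIV \<tau> \<in> ?G" by (simp add: inv_automorphisms_fixing)
    interpret \<tau>: field_embedding "inv_into UNIV \<tau>"
      by unfold_locales (use inv in \<open>simp add: automorphisms_fixing_iff\<close>)
    show "t \<in> ?T"
      using inv by (auto simp: \<tau>(2) \<Phi>_def \<alpha> simp flip: \<tau>.hom_power)
  qed
  moreover have finT: "finite ?T"
    using finite_embeddings nth_roots_bound(1)[OF m] by (intro finite_SigmaI)
  ultimately have fin: "finite (\<Phi> ` ?G)" and le: "card (\<Phi> ` ?G) \<le> card ?T"
    by (auto intro: finite_subset card_mono)
  have "card ?T = (\<Sum>u\<in>?U. card {y. y ^ m = u a})"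
    using finite_embeddings nth_roots_bound(1)[OF m] by (intro card_SigmaI) auto
  also have "\<dots> \<le> (\<Sum>u\<in>?U. m)"
    by (intro sum_mono nth_roots_bound(2) m)
  finally have cardT: "card ?T \<le> num_embeddings * m" by (simp add: num_embeddings_def)
  \<comment> \<open>\<open>\<Phi>\<close> determines the coset, so there are at most as many cosets
    as values of \<open>\<Phi>\<close>.\<close>
  have "?coset \<sigma> = ?coset \<tau>" if "\<sigma> \<in> ?G" "\<tau> \<in> ?G" "\<Phi> \<sigma> = \<Phi> \<tau>" for \<sigma> \<tau>
  proof -
    have "inv_into UNIV \<sigma> x = inv_into UNIV \<tau> x" if "x \<in> adjoin \<alpha>" for x
    proof (rule adjoin_eqI[where \<sigma> = "inv_into UNIV \<sigma>" and \<tau> = "inv_into UNIV \<tau>" and \<alpha> = \<alpha>])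
      show "field_extension (inv_into UNIV \<sigma>)" "field_extension (inv_into UNIV \<tau>)"
        using inv_automorphisms_fixing[OF \<open>\<sigma> \<in> ?G\<close>] inv_automorphisms_fixing[OF \<open>\<tau> \<in> ?G\<close>]
        by (simp_all add: automorphisms_fixing_iff)
    qed (use \<open>\<Phi> \<sigma> = \<Phi> \<tau>\<close> that in \<open>auto simp: \<Phi>_def fun_eq_iff\<close>)
    then show ?thesis
      using rcoset_eq_iff[OF range_to_ac_subset_adjoin that(1,2)] by blast
  qed
  then obtain h where "\<forall>\<tau>\<in>?G. ?coset \<tau> = h (\<Phi> \<tau>)"
    using factor_through[of ?G \<Phi> ?coset] by blast
  then have C': "?C = h ` \<Phi> ` ?G" unfolding C by (force simp: image_image)
  show "finite ?C" unfolding C' using fin by simp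
  show "card ?C \<le> num_embeddings * m"
    unfolding C' using card_image_le[OF fin, of h] le cardT by linarith
qed

text \<open>\<open>f a\<close> is the Kummer cocycle of \<open>a\<close> on \<open>GL\<close>,
  evaluated at inverses. It depends on the chosen root, so elements of one class may have different
  values; the claim is that equal values force equal classes.\<close>

lemma finite_power_classes:
  assumes perfect: "perfect_field TYPE('a)" and F: "type_F TYPE('a)" and m: "m \<ge> 1"
  obtains f :: "'b \<Rightarrow> ('a alg_closure \<Rightarrow> 'a alg_closure) \<Rightarrow> 'a alg_closure"
  where "finite (f ` (UNIV - {0}))"
    and "\<And>a b. a \<noteq> 0 \<Longrightarrow> b \<noteq> 0 \<Longrightarrow> f a = f b \<Longrightarrow> \<exists>c. c \<noteq> 0 \<and> a = c ^ m * b"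
proof -
  let ?G = "absolute_galois_group :: ('a alg_closure \<Rightarrow> _) monoid"
  have "\<exists>\<alpha>. \<alpha> ^ m = j a" for a
    using nth_root_exists[of m "j a"] m by auto
  then obtain rt where rt: "\<And>a. rt a ^ m = j a" by metis
  have rt_nz: "rt a \<noteq> 0" if "a \<noteq> 0" for a
  proof
    assume "rt a = 0"
    with rt[of a] m have "j a = 0" by (simp add: power_0_left)
    with that show False by simp
  qed
  define H where "H a = automorphisms_fixing (adjoin (rt a))" for a
  define GL where "GL = (automorphisms_fixing (range j) :: ('a alg_closure \<Rightarrow> _) set)"
  define \<mu> where "\<mu> = {z :: 'a alg_closure. z ^ m = 1}"
  \<comment> \<open>Restricted to \<open>GL\<close>, so that agreement on \<open>GL\<close> is
    equality of functions.\<close>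
  define f where "f a = restrict (\<lambda>\<tau>. inv_into UNIV \<tau> (rt a) / rt a) GL" for a
  \<comment> \<open>Type (F) gives finiteness for each single index; the uniform bound leaves
    finitely many indices.\<close>
  define HH where "HH = (\<Union>n\<in>{1..num_embeddings * m}.
     {H. subgroup H ?G \<and> openin krull_topology H \<and> card (rcosets\<^bsub>?G\<^esub> H) = n})"
  \<comment> \<open>The functions from \<open>GL\<close> to the \<open>m\<close>-th roots of unity
    that factor through the right cosets of \<open>U\<close>.\<close>
  define FF where "FF U = (\<lambda>h. restrict (\<lambda>\<tau>. h (U #>\<^bsub>?G\<^esub> \<tau>)) GL) `
     (PiE ((\<lambda>\<tau>. U #>\<^bsub>?G\<^esub> \<tau>) ` GL) (\<lambda>_. \<mu>))" for U
  have GL: "\<tau> \<in> galois_group" if "\<tau> \<in> GL" for \<tau>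
    using automorphisms_fixing_antimono[OF range_to_ac_subset] that by (auto simp: GL_def)
  have "finite HH"
    using F unfolding HH_def type_F_def by (intro finite_UN_I) auto
  have finite_FF: "finite (FF U)" if "U \<in> HH" for U
  proof -
    \<comment> \<open>Infinite sets have \<open>card\<close> 0, so a positive value certifies finite
      index.\<close>
    have "card (rcosets\<^bsub>?G\<^esub> U) \<ge> 1" using that by (auto simp: HH_def)
    then have "finite (rcosets\<^bsub>?G\<^esub> U)" by (metis card.infinite not_one_le_zero)
    moreover have "(\<lambda>\<tau>. U #>\<^bsub>?G\<^esub> \<tau>) ` GL \<subseteq> rcosets\<^bsub>?G\<^esub> U"
      using GL by (auto simp: RCOSETS_def absolute_galois_group_def)
    ultimately have "finite ((\<lambda>\<tau>. U #>\<^bsub>?G\<^esub> \<tau>) ` GL)" by (rule finite_subset[rotated])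
    moreover have "finite \<mu>" unfolding \<mu>_def using nth_roots_bound(1)[OF m] .
    ultimately show ?thesis unfolding FF_def by (intro finite_imageI[OF finite_PiE])
  qed
  have H_in: "H a \<in> HH" for a
  proof -
    let ?C = "rcosets\<^bsub>?G\<^esub> (H a)"
    \<comment> \<open>A coset showing that the index is not 0, as the indices in \<open>HH\<close>
      start at 1.\<close>
    have "H a #>\<^bsub>?G\<^esub> id \<in> ?C"
      by (auto simp: RCOSETS_def absolute_galois_group_def id_automorphisms_fixing)
    moreover have "finite ?C" "card ?C \<le> num_embeddings * m"
      unfolding H_def using index_adjoin_le[OF m rt] by blast+
    ultimately have "card ?C \<in> {1..num_embeddings * m}"
      by (auto simp: Suc_le_eq card_gt_0_iff)
    moreover have "subgroup (H a) ?G" "openin krull_topology (H a)"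
      unfolding H_def using range_to_ac_subset_adjoin finite_subextension_adjoin[OF m rt]
      by (simp_all add: subgroup_automorphisms_fixing openin_automorphisms_fixing)
    ultimately show ?thesis unfolding HH_def by blast
  qed
  have f_in: "f a \<in> FF (H a)" if a: "a \<noteq> 0" for a
  proof -
    let ?S = "(\<lambda>\<tau>. H a #>\<^bsub>?G\<^esub> \<tau>) ` GL"
    let ?v = "\<lambda>\<tau>. inv_into UNIV \<tau> (rt a) / rt a"
    \<comment> \<open>The coset determines the inverse on \<open>adjoin (rt a)\<close>, which
      contains the root.\<close>
    have "?v \<sigma> = ?v \<tau>" if "\<sigma> \<in> GL" "\<tau> \<in> GL" "H a #>\<^bsub>?G\<^esub> \<sigma> = H a #>\<^bsub>?G\<^esub> \<tau>" for \<sigma> \<tau>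
    proof -
      have "\<forall>x\<in>adjoin (rt a). inv_into UNIV \<sigma> x = inv_into UNIV \<tau> x"
        using that(3) rcoset_eq_iff[OF range_to_ac_subset_adjoin GL[OF that(1)] GL[OF that(2)]]
        by (simp add: H_def)
      then show ?thesis using adjoin_gen by simp
    qed
    then obtain h where h: "\<forall>\<tau>\<in>GL. ?v \<tau> = h (H a #>\<^bsub>?G\<^esub> \<tau>)"
      using factor_through[of GL "\<lambda>\<tau>. H a #>\<^bsub>?G\<^esub> \<tau>" ?v] by blast
    \<comment> \<open>The inverse of \<open>\<tau>\<close> fixes L, so it sends one
      \<open>m\<close>-th root of \<open>j a\<close> to another.\<close>
    have "?v \<tau> \<in> \<mu>" if "\<tau> \<in> GL" for \<tau>
    proof -
      have inv: "inv_into UNIV \<tau> \<in> GL"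
        using that inv_automorphisms_fixing by (simp add: GL_def)
      interpret \<tau>: field_embedding "inv_into UNIV \<tau>"
        by unfold_locales (use inv in \<open>simp add: GL_def automorphisms_fixing_iff\<close>)
      have "inv_into UNIV \<tau> (rt a) ^ m = j a"
        using inv by (simp add: rt GL_def automorphisms_fixing_iff flip: \<tau>.hom_power)
      then show ?thesis using a by (simp add: \<mu>_def power_divide rt)
    qed
    with h have "restrict h ?S \<in> PiE ?S (\<lambda>_. \<mu>)" by auto
    moreover have "f a = restrict (\<lambda>\<tau>. restrict h ?S (H a #>\<^bsub>?G\<^esub> \<tau>)) GL"
      using h by (auto simp: f_def restrict_def)
    ultimately show ?thesis unfolding FF_def by blast
  qed
  show thesis
  proof (rule that)
    have "finite (\<Union>U\<in>HH. FF U)" using \<open>finite HH\<close> finite_FF by blast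
    moreover have "f ` (UNIV - {0}) \<subseteq> (\<Union>U\<in>HH. FF U)" using f_in H_in by blast
    ultimately show "finite (f ` (UNIV - {0}))" by (rule finite_subset[rotated])
    show "\<exists>c. c \<noteq> 0 \<and> a = c ^ m * b" if a: "a \<noteq> 0" and b: "b \<noteq> 0" and eq: "f a = f b" for a b
    proof -
      have "rt a / rt b \<in> range j"
      proof (rule fixed_field[OF perfect range_to_ac_subset])
        show "x + y \<in> range j" if "x \<in> range j" "y \<in> range j" for x y
          using that by (auto simp flip: hom_add)
        show "x * y \<in> range j" if "x \<in> range j" "y \<in> range j" for x y
          using that by (auto simp flip: hom_mult)
        fix \<sigma> :: "'a alg_closure \<Rightarrow> 'a alg_closure" assume \<sigma>: "\<sigma> \<in> automorphisms_fixing (range j)"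
        interpret \<sigma>: field_embedding \<sigma>
          by unfold_locales (use \<sigma> in \<open>simp add: automorphisms_fixing_iff\<close>)
        have inv: "\<sigma> (inv_into UNIV \<sigma> x) = x" for x
          using \<sigma> by (simp add: automorphisms_fixing_iff bij_is_surj surj_f_inv_f)
        have "inv_into UNIV \<sigma> (rt a) / rt a = inv_into UNIV \<sigma> (rt b) / rt b"
          using fun_cong[OF eq, of \<sigma>] \<sigma> by (simp add: f_def GL_def)
        \<comment> \<open>Clear denominators and apply \<open>\<sigma>\<close>; this yields
          \<open>rt a * \<sigma> (rt b) = rt b * \<sigma> (rt a)\<close>.\<close>
        then have "\<sigma> (inv_into UNIV \<sigma> (rt a) * rt b) = \<sigma> (inv_into UNIV \<sigma> (rt b) * rt a)"
          using rt_nz a b by (simp add: frac_eq_eq)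
        then show "\<sigma> (rt a / rt b) = rt a / rt b"
          using rt_nz a b by (simp add: \<sigma>.hom_mult \<sigma>.hom_divide inv frac_eq_eq mult.commute)
      qed
      then obtain c where c: "rt a / rt b = j c" by blast
      \<comment> \<open>Raising to the \<open>m\<close>-th power turns roots back into elements of
        L, where \<open>j\<close> is injective.\<close>
      then have "j a = j (c ^ m * b)"
        using rt_nz[OF b] rt[of a] rt[of b]
        by (simp add: hom_mult hom_power c[symmetric] power_divide b)
      then have "a = c ^ m * b" by simp
      moreover have "c \<noteq> 0" using c rt_nz a b by auto
      ultimately show ?thesis by blast
    qed
  qed
qed

end

text \<open>The coset of \<open>a\<close> modulo \<open>m\<close>-th powers is a function of
  \<open>f a\<close>, so the quotient is an image of a finite set.\<close>

lemma finite_power_quotientI: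
  fixes f :: "'b::field \<Rightarrow> 'c"
  assumes fin: "finite (f ` (UNIV - {0}))"
    and eq: "\<And>a b. a \<noteq> 0 \<Longrightarrow> b \<noteq> 0 \<Longrightarrow> f a = f b \<Longrightarrow> \<exists>c. c \<noteq> 0 \<and> a = c ^ m * b"
  shows "finite (carrier (power_quotient TYPE('b) m))"
proof -
  let ?A = "ring_of_type_algebra :: 'b ring"
  interpret A: field ?A by (rule field_from_type_algebra)
  let ?U = "units_of ?A"
  have carrier: "carrier ?U = UNIV - {0}"
    by (simp add: units_of_carrier A.field_Units) (simp add: ring_of_type_algebra_def)
  have mult: "x \<otimes>\<^bsub>?U\<^esub> y = x * y" and one: "\<one>\<^bsub>?U\<^esub> = 1" for x y
    by (simp_all add: units_of_mult units_of_one ring_of_type_algebra_def)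
  have pow: "x [^]\<^bsub>?U\<^esub> n = x ^ n" for x and n :: nat
    by (induction n) (simp_all add: nat_pow_def mult one mult.commute)
  define P where "P = (\<lambda>x. x [^]\<^bsub>?U\<^esub> m) ` carrier ?U"
  have coset: "P #>\<^bsub>?U\<^esub> a = {x ^ m * a |x. x \<noteq> 0}" for a
    by (auto simp: P_def r_coset_def carrier mult pow)
  have "P #>\<^bsub>?U\<^esub> a = P #>\<^bsub>?U\<^esub> b" if ab: "a \<in> UNIV - {0}" "b \<in> UNIV - {0}" "f a = f b" for a b
  proof -
    obtain c where c: "c \<noteq> 0" "a = c ^ m * b" using eq ab by blast
    \<comment> \<open>The substitutions \<open>x * c\<close> and \<open>x / c\<close> give the two
      inclusions between the cosets.\<close>
    have "x ^ m * a = (x * c) ^ m * b" "x ^ m * b = (x / c) ^ m * a" for x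
      using c by (simp_all add: power_mult_distrib power_divide)
    then show ?thesis unfolding coset using c(1)
      by (metis (no_types, lifting) divide_eq_0_iff mult_eq_0_iff)
  qed
  then obtain h where "\<forall>a\<in>UNIV - {0}. P #>\<^bsub>?U\<^esub> a = h (f a)"
    using factor_through[of "UNIV - {0}" f "\<lambda>a. P #>\<^bsub>?U\<^esub> a"] by blast
  then have "carrier (?U Mod P) = h ` f ` (UNIV - {0})"
    by (force simp: carrier_FactGroup carrier image_image)
  then show ?thesis using fin by (simp add: power_quotient_def Let_def P_def)
qed

theorem lemma2p4:
  assumes "perfect_field TYPE('a::field)"
    and "type_F TYPE('a)"
  shows "\<forall>m\<ge>1. \<not> CHAR('a) dvd m \<longrightarrow> type_F' TYPE('a) TYPE('b::field) m"
  unfolding type_F'_def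
proof (intro allI impI)
  fix m :: nat and i :: "'a \<Rightarrow> 'b"
  assume m: "m \<ge> 1" and i: "finite_field_extension i \<and> separable_field_extension i"
  obtain B where B: "finite B" "span_over i B = UNIV" and ext: "field_extension i"
    using i by (auto simp: finite_field_extension_def)
  \<comment> \<open>Irreducible polynomials are nonzero, so those provided by separability witness
    algebraicity.\<close>
  interpret i: algebraic_embedding i
  proof
    show "field_extension i" by (rule ext)
    show "\<exists>p. p \<noteq> 0 \<and> poly (map_poly i p) x = 0" for x
      using i unfolding separable_field_extension_def by (metis Factorial_Ring.not_irreducible_zero)
  qed
  interpret embeddings_into_closed i "to_ac :: 'a \<Rightarrow> _"
    by (intro embeddings_into_closed.intro two_embeddings.intro i.algebraic_embedding_axioms
        field_embedding_to_ac)
  \<comment> \<open>L is embedded into Kbar over K by extending the isomorphism between the copies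
    of K.\<close>
  obtain j where j: "field_extension j" "\<And>x y. (x, y) \<in> range (\<lambda>k. (i k, to_ac k)) \<Longrightarrow> j x = y"
    using partial_hom_extend[OF partial_hom_base_graph] by blast
  interpret finite_intermediate_field i j B
    by unfold_locales (use j B in auto)
  obtain f :: "'b \<Rightarrow> ('a alg_closure \<Rightarrow> 'a alg_closure) \<Rightarrow> 'a alg_closure"
    where "finite (f ` (UNIV - {0}))"
      and "\<And>a b. a \<noteq> 0 \<Longrightarrow> b \<noteq> 0 \<Longrightarrow> f a = f b \<Longrightarrow> \<exists>c. c \<noteq> 0 \<and> a = c ^ m * b"
    using finite_power_classes[OF assms m] by blast
  then show "finite (carrier (power_quotient TYPE('b) m))"
    by (rule finite_power_quotientI)
qed

end
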